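(* Let $\Omega$ be a uniformly elliptic domain in a (complex) Hilbert space $H$. Then $\Omega$ is HHR.
   Context: All Banach and Hilbert spaces are over $\mathbb{C}$. A domain is a nonempty connected open set. $B_V(p,r)=\{z\in V:\|z-p\|<r\}$ and $\partial$ denotes topological boundary. **Uniformly elliptic.** A bounded convex domain $\Omega$ in a complex Banach space $V$ is uniformly elliptic if there exist universal constants $r,R$ with $0<r<R$ such that to each $q\in\partial\Omega$ there correspond two unique points $q',q''\in V$, colinear to $q$ (that is, $q,q',q''$ lie on a common real line), satisfying (1) $B_V(q',r)\subset\Omega\subset B_V(q'',R)$; (2) $q\in\partial B_V(q',r)\cap\partial B_V(q'',R)$, that is, $q$ is a common boundary point of $B_V(q',r)$, $B_V(q'',R)$ and $\Omega$. For a domain in a Hilbert space $H$ this is understood with $V=H$ and the Hilbert norm. **HHR.** For a Hilbert space $H$, $B_H$ is its open unit ball (a Hilbert ball) and $rB_H=\{x\in H:\|x\|<r\}$. A holomorphic embedding $f:D_1\to D_2$ of domains is a map such that $f(D_1)$ is a domain in $D_2$ and $f$ is biholomorphic onto $f(D_1)$. For a bounded domain $D$ in a Banach space $V$, $H(D,B_H)$ is the set of holomorphic embeddings of $D$ into $B_H$ (nonempty iff $V$ is linearly homeomorphic to $H$). If $H(D,B_H)\neq\emptyset$, put $$\sigma_D(p)=\sup\{r>0:rB_H\subset f(D)\text{ for some }f\in H(D,B_H)\text{ with }f(p)=0\}\in(0,1]$$ (independent of the choice of $H$). $D$ is HHR (holomorphic homogeneous regular) if it admits a holomorphic embedding into some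 Hilbert ball and $\inf_{p\in D}\sigma_D(p)>0$. *)

theory Defs
  imports "HOL-Analysis.Analysis"
begin

section \<open>Complex Banach and Hilbert spaces\<close>

class complex_vector = real_vector +
  fixes scaleC :: "complex \<Rightarrow> 'a \<Rightarrow> 'a"  (infixr "*\<^sub>C" 75)
  assumes scaleC_add_right: "a *\<^sub>C (x + y) = a *\<^sub>C x + a *\<^sub>C y"
    and scaleC_add_left: "(a + b) *\<^sub>C x = a *\<^sub>C x + b *\<^sub>C x"
    and scaleC_scaleC: "a *\<^sub>C b *\<^sub>C x = (a * b) *\<^sub>C x"
    and scaleC_one: "1 *\<^sub>C x = x"
    and scaleR_scaleC: "r *\<^sub>R x = complex_of_real r *\<^sub>C x"

class complex_normed_vector = complex_vector + real_normed_vector +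
  assumes norm_scaleC: "norm (a *\<^sub>C x) = cmod a * norm x"

class complex_banach = complex_normed_vector + complete_space

class complex_inner = complex_normed_vector +
  fixes cinner :: "'a \<Rightarrow> 'a \<Rightarrow> complex"
  assumes cinner_commute: "cinner x y = cnj (cinner y x)"
    and cinner_add_left: "cinner (x + y) z = cinner x z + cinner y z"
    and cinner_scaleC_left: "cinner (a *\<^sub>C x) y = a * cinner x y"
    and cinner_ge_zero: "0 \<le> Re (cinner x x)"
    and cinner_eq_zero_iff: "cinner x x = 0 \<longleftrightarrow> x = 0"
    and norm_eq_sqrt_cinner: "norm x = sqrt (Re (cinner x x))"

class complex_hilbert = complex_inner + complete_space
begin

subclass complex_banach ..

end

instantiation complex :: complex_hilbert
begin

definition scaleC_complex :: "complex \<Rightarrow> complex \<Rightarrow> complex"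
  where "scaleC_complex a x = a * x"

definition cinner_complex :: "complex \<Rightarrow> complex \<Rightarrow> complex"
  where "cinner_complex x y = x * cnj y"

instance
proof
  fix a b x y z :: complex and r :: real
  show "a *\<^sub>C (x + y) = a *\<^sub>C x + a *\<^sub>C y" "(a + b) *\<^sub>C x = a *\<^sub>C x + b *\<^sub>C x"
    "a *\<^sub>C b *\<^sub>C x = (a * b) *\<^sub>C x" "1 *\<^sub>C x = x"
    by (simp_all add: scaleC_complex_def distrib_left distrib_right mult.assoc)
  show "r *\<^sub>R x = complex_of_real r *\<^sub>C x"
    by (simp add: scaleC_complex_def scaleR_conv_of_real)
  show "norm (a *\<^sub>C x) = cmod a * norm x"
    by (simp add: scaleC_complex_def norm_mult)
  show "cinner x y = cnj (cinner y x)"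
    by (simp add: cinner_complex_def)
  show "cinner (x + y) z = cinner x z + cinner y z"
    by (simp add: cinner_complex_def distrib_right)
  show "cinner (a *\<^sub>C x) y = a * cinner x y"
    by (simp add: cinner_complex_def scaleC_complex_def)
  show "0 \<le> Re (cinner x x)" "norm x = sqrt (Re (cinner x x))"
    by (simp_all add: cinner_complex_def cmod_def power2_eq_square)
  show "cinner x x = 0 \<longleftrightarrow> x = 0"
    by (simp add: cinner_complex_def)
qed

end

section \<open>Domains and holomorphic embeddings\<close>

definition is_domain :: "'a::complex_normed_vector set \<Rightarrow> bool"
  where "is_domain D \<longleftrightarrow> D \<noteq> {} \<and> open D \<and> connected D"

definition holo_on ::
    "('a::complex_normed_vector \<Rightarrow> 'b::complex_normed_vector) \<Rightarrow> 'a set \<Rightarrow> bool"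
    (infix "holo'_on" 50)
  where "f holo_on D \<longleftrightarrow>
    (\<forall>x\<in>D. \<exists>f'. (f has_derivative f') (at x) \<and> (\<forall>c v. f' (c *\<^sub>C v) = c *\<^sub>C f' v))"

definition biholomorphic_onto ::
    "('a::complex_normed_vector \<Rightarrow> 'b::complex_normed_vector) \<Rightarrow> 'a set \<Rightarrow> 'b set \<Rightarrow> bool"
  where "biholomorphic_onto f D E \<longleftrightarrow>
    bij_betw f D E \<and> f holo_on D \<and> inv_into D f holo_on E"

definition holo_embeddings ::
    "'a::complex_normed_vector set \<Rightarrow> 'b::complex_normed_vector set \<Rightarrow> ('a \<Rightarrow> 'b) set"
  where "holo_embeddings D E =
    {f. f ` D \<subseteq> E \<and> is_domain (f ` D) \<and> biholomorphic_onto f D (f ` D)}"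

section \<open>Uniformly elliptic domains\<close>

definition uniformly_elliptic :: "'a::complex_banach set \<Rightarrow> bool"
  where "uniformly_elliptic \<Omega> \<longleftrightarrow>
    is_domain \<Omega> \<and> bounded \<Omega> \<and> convex \<Omega> \<and>
    (\<exists>r R. 0 < r \<and> r < R \<and>
      (\<forall>q\<in>frontier \<Omega>. \<exists>!p. case p of (q', q'') \<Rightarrow>
        collinear {q, q', q''} \<and>
        ball q' r \<subseteq> \<Omega> \<and> \<Omega> \<subseteq> ball q'' R \<and>
        q \<in> frontier (ball q' r) \<inter> frontier (ball q'' R)))"

section \<open>Holomorphic homogeneous regular domains\<close>

text \<open>
  HOL cannot quantify over types inside a formula, so the Hilbert space whose unit ball is the
  target is an explicit type argument; the squeezing function does not depend on its choice.
  Values are extended reals because over the zero space, whose balls all coincide, the supremum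
  is infinite; in all other cases it is at most 1.
\<close>

definition squeezing :: "'h::complex_hilbert itself \<Rightarrow> 'a::complex_banach set \<Rightarrow> 'a \<Rightarrow> ereal"
  where "squeezing H D p =
    Sup {ereal r | r. 0 < r \<and>
      (\<exists>f \<in> holo_embeddings D (ball (0::'h) 1). f p = 0 \<and> ball 0 r \<subseteq> f ` D)}"

definition HHR :: "'h::complex_hilbert itself \<Rightarrow> 'a::complex_banach set \<Rightarrow> bool"
  where "HHR H D \<longleftrightarrow>
    is_domain D \<and> bounded D \<and>
    holo_embeddings D (ball (0::'h) 1) \<noteq> {} \<and>
    0 < (INF p\<in>D. squeezing H D p)"

end

theory Submission
  imports Defs
begin

text \<open>
  Let \<open>q\<close> be a boundary point with inward unit normal \<open>e\<close>, and split \<open>z - q = \<zeta> e + z'\<close> with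
  \<open>\<zeta> = \<langle>z - q, e\<rangle>\<close> and \<open>z'\<close> orthogonal to \<open>e\<close>. In these coordinates the two balls tangent at
  \<open>q\<close> say that the domain contains \<open>|\<zeta>|\<^sup>2 + |z'|\<^sup>2 < 2 r Re \<zeta>\<close> and lies in
  \<open>|\<zeta>|\<^sup>2 + |z'|\<^sup>2 < 2 R Re \<zeta>\<close>. At a point of depth \<open>\<delta>\<close> below \<open>q\<close> the domain thus looks like a
  region of size \<open>\<delta>\<close> in the complex normal direction and \<open>\<surd>\<delta>\<close> in the complex tangential ones, and
  the Cayley transform
  \<open>\<zeta> e + z' \<mapsto> ((\<zeta> - \<delta>) e + \<surd>\<delta> z') / (\<zeta> + \<delta>)\<close>
  undoes precisely this anisotropy: it sends \<open>q + \<delta> e\<close> to \<open>0\<close>, its image of the outer ball is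
  bounded by a constant that depends on \<open>R\<close> only (\<open>cayley_bounded\<close>), and for \<open>\<delta> \<le> r / 2\<close> its image
  of the inner ball contains a ball about \<open>0\<close> whose radius depends on \<open>r\<close> only
  (\<open>cayley_inv_in_inner_ball\<close>).

  Given \<open>p\<close> at distance \<open>\<delta>\<close> from the boundary, one would take for \<open>q\<close> a nearest boundary point, so
  that \<open>p = q + \<delta> e\<close>. Bounded closed sets in infinite dimension are not compact, so only
  near-minimizers are at hand immediately. They suffice: the domain lies in the half-space
  \<open>Re \<zeta> > 0\<close>, which forces \<open>p\<close> to lie almost on the normal through a near-minimizer, with an error
  that is as small a multiple of \<open>\<delta>\<close> as desired (\<open>nearly_normal_boundary_point\<close>). The Cayley
  transform then sends \<open>p\<close> close to \<open>0\<close> (\<open>cayley_near_center\<close>), and a translation followed by a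
  dilation turns it into an embedding into the unit ball that takes \<open>p\<close> to \<open>0\<close>
  (\<open>pinched_image_embedding\<close>). If the ball of radius \<open>r / 2\<close> about \<open>p\<close> lies in the domain, such a
  similarity of the bounded domain itself does.
\<close>

section \<open>Holomorphic maps\<close>

lemma bounded_bilinear_scaleC:
  "bounded_bilinear ((*\<^sub>C) :: complex \<Rightarrow> 'a::complex_normed_vector \<Rightarrow> 'a)"
proof
  fix a a' :: complex and b b' :: 'a and r :: real
  show "(a + a') *\<^sub>C b = a *\<^sub>C b + a' *\<^sub>C b" by (rule scaleC_add_left)
  show "a *\<^sub>C (b + b') = a *\<^sub>C b + a *\<^sub>C b'" by (rule scaleC_add_right)
  show "(r *\<^sub>R a) *\<^sub>C b = r *\<^sub>R (a *\<^sub>C b)"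
    by (simp add: scaleR_scaleC scaleC_scaleC scaleC_complex_def)
  show "a *\<^sub>C (r *\<^sub>R b) = r *\<^sub>R (a *\<^sub>C b)"
    by (simp add: scaleR_scaleC scaleC_scaleC mult.commute)
  show "\<exists>K. \<forall>(a::complex) (b::'a). norm (a *\<^sub>C b) \<le> norm a * norm b * K"
    by (rule exI[of _ 1]) (simp add: norm_scaleC)
qed

interpretation scaleC: bounded_bilinear
  "(*\<^sub>C) :: complex \<Rightarrow> 'a::complex_normed_vector \<Rightarrow> 'a"
  by (rule bounded_bilinear_scaleC)

lemma holo_on_imp_continuous_on:
  assumes "f holo_on D"
  shows "continuous_on D f"
proof (rule continuous_at_imp_continuous_on, rule ballI)
  fix x assume "x \<in> D"
  with assms obtain f' where "(f has_derivative f') (at x)"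
    unfolding holo_on_def by blast
  then show "isCont f x" by (rule has_derivative_continuous)
qed

lemma holo_on_compose:
  assumes "f holo_on D" and "g holo_on E" and "f ` D \<subseteq> E"
  shows "(\<lambda>x. g (f x)) holo_on D"
  unfolding holo_on_def
proof
  fix x assume x: "x \<in> D"
  with assms(1) obtain f' where f': "(f has_derivative f') (at x)"
    "\<forall>c v. f' (c *\<^sub>C v) = c *\<^sub>C f' v"
    unfolding holo_on_def by blast
  from x assms(3) have "f x \<in> E" by blast
  with assms(2) obtain g' where g': "(g has_derivative g') (at (f x))"
    "\<forall>c v. g' (c *\<^sub>C v) = c *\<^sub>C g' v"
    unfolding holo_on_def by blast
  have "((\<lambda>x. g (f x)) has_derivative (\<lambda>v. g' (f' v))) (at x)"
    using f'(1) g'(1) by (rule has_derivative_compose)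
  with f'(2) g'(2)
  show "\<exists>h. ((\<lambda>x. g (f x)) has_derivative h) (at x) \<and> (\<forall>c v. h (c *\<^sub>C v) = c *\<^sub>C h v)"
    by (intro exI[of _ "\<lambda>v. g' (f' v)"]) simp
qed

lemma holo_on_affine:
  fixes a :: "'a::complex_normed_vector"
  shows "(\<lambda>x. a + t *\<^sub>R x) holo_on D"
  unfolding holo_on_def
proof
  fix x assume "x \<in> D"
  have "((\<lambda>x. a + t *\<^sub>R x) has_derivative (\<lambda>v. t *\<^sub>R v)) (at x)"
    by (auto intro!: derivative_eq_intros)
  moreover have "t *\<^sub>R (c *\<^sub>C v) = c *\<^sub>C (t *\<^sub>R v)" for c and v :: 'a
    by (rule scaleC.scaleR_right[symmetric])
  ultimately show "\<exists>h. ((\<lambda>x. a + t *\<^sub>R x) has_derivative h) (at x) \<and> (\<forall>c v. h (c *\<^sub>C v) = c *\<^sub>C h v)"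
    by blast
qed

text \<open>
  With a holomorphic left inverse \<open>g\<close> on an open set, openness of the image needs no inverse
  function theorem: the image is the part of \<open>U\<close> that \<open>g\<close> sends into \<open>D\<close>.
\<close>

lemma holo_embeddingI:
  assumes D: "is_domain D" and f: "f holo_on D" and fD: "f ` D \<subseteq> E"
    and U: "open U" and g: "g holo_on U" and fU: "f ` D \<subseteq> U"
    and gf: "\<And>z. z \<in> D \<Longrightarrow> g (f z) = z"
    and fg: "\<And>w. w \<in> U \<Longrightarrow> g w \<in> D \<Longrightarrow> f (g w) = w"
  shows "f \<in> holo_embeddings D E"
proof -
  have image: "f ` D = U \<inter> g -` D"
    using fU gf fg by (auto simp: image_iff) metis
  have op: "open (f ` D)"
    unfolding image using D U holo_on_imp_continuous_on[OF g]
    by (auto simp: is_domain_def intro: continuous_open_preimage)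
  have "connected (f ` D)"
    using D holo_on_imp_continuous_on[OF f]
    by (auto simp: is_domain_def intro: connected_continuous_image)
  with op D have dom: "is_domain (f ` D)"
    by (auto simp: is_domain_def)
  have inj: "inj_on f D"
    by (rule inj_on_inverseI[of _ g]) (rule gf)
  have inv: "inv_into D f w = g w" if "w \<in> f ` D" for w
    using that inj gf by auto
  have "inv_into D f holo_on f ` D"
    unfolding holo_on_def
  proof
    fix w assume w: "w \<in> f ` D"
    with fU have "w \<in> U" by blast
    with g obtain g' where g': "(g has_derivative g') (at w)"
      "\<forall>c v. g' (c *\<^sub>C v) = c *\<^sub>C g' v"
      unfolding holo_on_def by blast
    have "(inv_into D f has_derivative g') (at w)"
      using g'(1) op w by (rule has_derivative_transform_within_open) (simp add: inv)
    with g'(2) show "\<exists>h. (inv_into D f has_derivative h) (at w) \<and> (\<forall>c v. h (c *\<^sub>C v) = c *\<^sub>C h v)"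
      by blast
  qed
  with f inj have "biholomorphic_onto f D (f ` D)"
    by (simp add: biholomorphic_onto_def inj_on_imp_bij_betw)
  with fD dom show ?thesis
    by (simp add: holo_embeddings_def)
qed

text \<open>
  The similarity that takes \<open>ball (f p) M\<close> to the unit ball turns \<open>f\<close> into a competitor for the
  squeezing function at \<open>p\<close>. Only the ratio of the two radii matters, so \<open>f\<close> may be chosen without
  regard to where it sends \<open>p\<close> or to the size of its image.
\<close>

lemma pinched_image_embedding:
  fixes f :: "'a::complex_hilbert \<Rightarrow> 'b::complex_hilbert"
  assumes D: "is_domain D" and f: "f holo_on D"
    and U: "open U" and g: "g holo_on U" and fU: "f ` D \<subseteq> U"
    and gf: "\<And>z. z \<in> D \<Longrightarrow> g (f z) = z"
    and fg: "\<And>w. w \<in> U \<Longrightarrow> g w \<in> D \<Longrightarrow> f (g w) = w"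
    and "0 < M" and outer: "f ` D \<subseteq> ball (f p) M" and inner: "ball (f p) \<rho> \<subseteq> f ` D"
  shows "\<exists>F \<in> holo_embeddings D (ball (0::'b) 1). F p = 0 \<and> ball 0 (\<rho> / M) \<subseteq> F ` D"
proof -
  define S where "S = (\<lambda>w. - (1 / M) *\<^sub>R f p + (1 / M) *\<^sub>R w)"
  define T where "T = (\<lambda>w. f p + M *\<^sub>R w)"
  have TS: "T (S w) = w" and ST: "S (T w) = w" for w
    using \<open>0 < M\<close> by (simp_all add: S_def T_def scaleR_add_right scaleR_diff_right)
  have S_holo: "S holo_on X" and T_holo: "T holo_on X" for X
    unfolding S_def T_def by (rule holo_on_affine)+
  have S_norm: "norm (S w) = dist (f p) w / M" for w
  proof -
    have "S w = (1 / M) *\<^sub>R (w - f p)"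
      by (simp add: S_def scaleR_diff_right)
    then show ?thesis
      using \<open>0 < M\<close> by (simp add: dist_norm norm_minus_commute)
  qed
  have emb: "(\<lambda>z. S (f z)) \<in> holo_embeddings D (ball 0 1)"
  proof (rule holo_embeddingI[where U = "T -` U" and g = "\<lambda>w. g (T w)"])
    show "(\<lambda>z. S (f z)) holo_on D"
      using f S_holo[of UNIV] by (rule holo_on_compose) simp
    show "(\<lambda>z. S (f z)) ` D \<subseteq> ball 0 1"
      using outer \<open>0 < M\<close> by (auto simp: S_norm)
    show "open (T -` U)"
      using U holo_on_imp_continuous_on[OF T_holo[of UNIV]] by (rule open_vimage)
    show "(\<lambda>w. g (T w)) holo_on T -` U"
      using T_holo[of "T -` U"] g by (rule holo_on_compose) auto
  qed (use D fU gf fg in \<open>auto simp: TS ST\<close>)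
  have "ball 0 (\<rho> / M) \<subseteq> (\<lambda>z. S (f z)) ` D"
  proof
    fix w :: 'b assume "w \<in> ball 0 (\<rho> / M)"
    then have "T w \<in> ball (f p) \<rho>"
      using \<open>0 < M\<close> by (simp add: T_def dist_norm field_simps)
    with inner obtain z where "z \<in> D" "T w = f z" by blast
    then show "w \<in> (\<lambda>z. S (f z)) ` D"
      using ST[of w] by auto
  qed
  moreover have "S (f p) = 0" by (simp add: S_def)
  ultimately show ?thesis by (intro bexI[OF _ emb] conjI)
qed

section \<open>Orthogonal splitting along a unit vector\<close>

lemma cinner_diff_left: "cinner (x - y) (z::'a::complex_inner) = cinner x z - cinner y z"
  using cinner_add_left[of "x - y" y z] by simp

lemma cinner_scaleR_left: "cinner (t *\<^sub>R x) (y::'a::complex_inner) = t * cinner x y"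
  by (simp add: scaleR_scaleC cinner_scaleC_left)

lemma cinner_self: "cinner x x = (norm (x::'a::complex_inner))\<^sup>2"
proof -
  have "Im (cinner x x) = 0"
    using arg_cong[OF cinner_commute[of x x], of Im] by simp
  moreover have "Re (cinner x x) = (norm x)\<^sup>2"
    by (simp add: norm_eq_sqrt_cinner cinner_ge_zero)
  ultimately show ?thesis by (simp add: complex_eq_iff)
qed

lemma norm_add_sq:
  fixes x y :: "'a::complex_inner"
  shows "(norm (x + y))\<^sup>2 = (norm x)\<^sup>2 + 2 * Re (cinner x y) + (norm y)\<^sup>2"
proof -
  have sq: "(norm z)\<^sup>2 = Re (cinner z z)" for z :: 'a
    by (simp add: cinner_self)
  have right: "Re (cinner z (x + y)) = Re (cinner z x) + Re (cinner z y)" for z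
    using cinner_commute[of z "x + y"] cinner_commute[of z x] cinner_commute[of z y]
    by (simp add: cinner_add_left)
  have "Re (cinner y x) = Re (cinner x y)"
    using cinner_commute[of y x] by simp
  then show ?thesis
    by (simp add: sq cinner_add_left right)
qed

lemma norm_diff_scaleR_sq:
  fixes x e :: "'a::complex_inner"
  assumes "norm e = 1"
  shows "(norm (x - t *\<^sub>R e))\<^sup>2 = (norm x)\<^sup>2 - 2 * t * Re (cinner x e) + t\<^sup>2"
proof -
  have "Re (cinner x (- t *\<^sub>R e)) = - t * Re (cinner x e)"
    using cinner_commute[of x "- t *\<^sub>R e"] cinner_commute[of x e]
    by (simp add: cinner_scaleR_left flip: scaleR_minus_left)
  then show ?thesis
    using norm_add_sq[of x "- t *\<^sub>R e"] assms by simp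
qed

definition perp :: "'a::complex_inner \<Rightarrow> 'a \<Rightarrow> 'a"
  where "perp e z = z - cinner z e *\<^sub>C e"

text \<open>
  Maps of this form are closed under composition and act on the two summands of the splitting by
  scalar functions of the axial coordinate alone, so that inverting and estimating them reduces to
  one complex variable.
\<close>

definition axial ::
    "'a::complex_inner \<Rightarrow> (complex \<Rightarrow> complex) \<Rightarrow> (complex \<Rightarrow> complex) \<Rightarrow> 'a \<Rightarrow> 'a"
  where "axial e A B z = A (cinner z e) *\<^sub>C e + B (cinner z e) *\<^sub>C perp e z"

lemma cinner_perp: "norm e = 1 \<Longrightarrow> cinner (perp e z) e = 0"
  by (simp add: perp_def cinner_diff_left cinner_scaleC_left cinner_self)

lemma axial_coord:
  "norm e = 1 \<Longrightarrow> cinner (axial e A B z) e = A (cinner z e)"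
  by (simp add: axial_def cinner_add_left cinner_scaleC_left cinner_perp cinner_self)

lemma axial_perp:
  "norm e = 1 \<Longrightarrow> perp e (axial e A B z) = B (cinner z e) *\<^sub>C perp e z"
  unfolding perp_def[of e "axial e A B z"] axial_coord by (simp add: axial_def)

lemma axial_axial:
  "norm e = 1 \<Longrightarrow>
    axial e A B (axial e A' B' z) = axial e (\<lambda>\<zeta>. A (A' \<zeta>)) (\<lambda>\<zeta>. B (A' \<zeta>) * B' \<zeta>) z"
  unfolding axial_def[of e A B] axial_def[of e "\<lambda>\<zeta>. A (A' \<zeta>)"]
  by (simp add: axial_coord axial_perp scaleC_scaleC)

lemma axial_eq_self:
  "A (cinner z e) = cinner z e \<Longrightarrow> B (cinner z e) = 1 \<Longrightarrow> axial e A B z = z"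
  by (simp add: axial_def scaleC_one perp_def)

lemma norm_split:
  assumes "norm e = 1"
  shows "(norm z)\<^sup>2 = (cmod (cinner z e))\<^sup>2 + (norm (perp e z))\<^sup>2"
proof -
  have z: "z = perp e z + cinner z e *\<^sub>C e" by (simp add: perp_def)
  have "cinner e (perp e z) = 0"
    by (subst cinner_commute) (simp add: cinner_perp[OF assms])
  then have "cinner (perp e z) (cinner z e *\<^sub>C e) = 0"
    by (subst cinner_commute) (simp add: cinner_scaleC_left)
  then show ?thesis
    using norm_add_sq[of "perp e z" "cinner z e *\<^sub>C e"] assms
    by (simp flip: z add: norm_scaleC)
qed

lemma norm_axial:
  assumes "norm e = 1"
  shows "(norm (axial e A B z))\<^sup>2 =
    (cmod (A (cinner z e)))\<^sup>2 + (cmod (B (cinner z e)))\<^sup>2 * (norm (perp e z))\<^sup>2"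
  using norm_split[OF assms, of "axial e A B z"]
  by (simp add: axial_coord axial_perp assms norm_scaleC power_mult_distrib)

lemma bounded_linear_cinner_left:
  fixes e :: "'a::complex_inner"
  assumes "norm e = 1"
  shows "bounded_linear (\<lambda>z. cinner z e)"
proof (rule bounded_linear_intro)
  show "norm (cinner x e) \<le> norm x * 1" for x
    using norm_split[OF assms, of x] by (simp add: power2_le_imp_le)
qed (simp_all add: cinner_add_left cinner_scaleR_left scaleR_conv_of_real)

lemma holo_on_axial:
  fixes e :: "'a::complex_inner"
  assumes e: "norm e = 1"
    and A: "\<And>z. z \<in> D \<Longrightarrow> (A has_field_derivative A' (cinner z e)) (at (cinner z e))"
    and B: "\<And>z. z \<in> D \<Longrightarrow> (B has_field_derivative B' (cinner z e)) (at (cinner z e))"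
  shows "axial e A B holo_on D"
  unfolding holo_on_def
proof
  fix z assume z: "z \<in> D"
  note l = bounded_linear_imp_has_derivative[OF bounded_linear_cinner_left[OF e]]
  have dA: "((\<lambda>z. A (cinner z e)) has_derivative (\<lambda>v. A' (cinner z e) * cinner v e)) (at z)"
    using has_derivative_compose[OF l A[OF z, unfolded has_field_derivative_def]] .
  have dB: "((\<lambda>z. B (cinner z e)) has_derivative (\<lambda>v. B' (cinner z e) * cinner v e)) (at z)"
    using has_derivative_compose[OF l B[OF z, unfolded has_field_derivative_def]] .
  have dP: "(perp e has_derivative perp e) (at z)"
    unfolding perp_def
    using has_derivative_diff[OF has_derivative_ident
        scaleC.FDERIV[OF l has_derivative_const[of e]]]
    by (simp add: scaleC.zero_right)
  let ?h = "\<lambda>v. (A' (cinner z e) * cinner v e) *\<^sub>C e +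
    (B (cinner z e) *\<^sub>C perp e v + (B' (cinner z e) * cinner v e) *\<^sub>C perp e z)"
  have "(axial e A B has_derivative ?h) (at z)"
    unfolding axial_def
    using has_derivative_add[OF scaleC.FDERIV[OF dA has_derivative_const[of e]]
        scaleC.FDERIV[OF dB dP]]
    by (simp add: scaleC.zero_right)
  moreover have "?h (c *\<^sub>C v) = c *\<^sub>C ?h v" for c v
    by (simp add: perp_def cinner_scaleC_left scaleC_add_right scaleC.diff_right scaleC_scaleC mult_ac)
  ultimately show "\<exists>h. (axial e A B has_derivative h) (at z) \<and> (\<forall>c v. h (c *\<^sub>C v) = c *\<^sub>C h v)"
    by blast
qed

section \<open>Tangent balls and nearly normal boundary points\<close>

lemma ball_tangent_iff:
  fixes q e z :: "'a::complex_inner"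
  assumes "norm e = 1" "0 < t"
  shows "z \<in> ball (q + t *\<^sub>R e) t \<longleftrightarrow> (norm (z - q))\<^sup>2 < 2 * t * Re (cinner (z - q) e)"
proof -
  have "z \<in> ball (q + t *\<^sub>R e) t \<longleftrightarrow> norm (z - q - t *\<^sub>R e) < t"
    by (simp add: dist_norm norm_minus_commute algebra_simps)
  also have "\<dots> \<longleftrightarrow> (norm (z - q - t *\<^sub>R e))\<^sup>2 < t\<^sup>2"
    using assms(2) by (simp add: power_mono_iff flip: not_le)
  finally show ?thesis
    by (simp add: norm_diff_scaleR_sq assms(1))
qed

text \<open>
  Both centers lie on one real line through \<open>q\<close>, at distances \<open>r\<close> and \<open>R\<close>. On opposite sides they
  would be \<open>r + R\<close> apart, too far for the first to lie in the ball about the second.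
\<close>

lemma tangent_ball_centers:
  fixes q q' q'' :: "'a::complex_inner"
  assumes "0 < r" "0 < R" and col: "collinear {q, q', q''}"
    and r: "norm (q' - q) = r" and R: "norm (q'' - q) = R" and near: "dist q' q'' < R"
  obtains e where "norm e = 1" "q' = q + r *\<^sub>R e" "q'' = q + R *\<^sub>R e"
proof -
  define e where "e = (1 / r) *\<^sub>R (q' - q)"
  have e1: "norm e = 1" and q': "q' = q + r *\<^sub>R e"
    using r \<open>0 < r\<close> by (auto simp: e_def)
  have "collinear {q', q, q''}"
    using col by (simp add: insert_commute)
  then have "collinear {0, q' - q, q'' - q}"
    by (simp add: collinear_3)
  then obtain c where "q'' - q = c *\<^sub>R (q' - q)"
    using r R assms(1,2) by (auto simp: collinear_lemma)
  then have q'': "q'' = q + (c * r) *\<^sub>R e"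
    using q' by (simp add: algebra_simps)
  with R e1 have "\<bar>c * r\<bar> = R" by simp
  moreover have "c * r \<noteq> - R"
  proof
    assume "c * r = - R"
    with q' q'' have "q' - q'' = (r + R) *\<^sub>R e"
      by (simp add: algebra_simps)
    with near e1 assms(1,2) show False
      by (simp add: dist_norm)
  qed
  ultimately have "q'' = q + R *\<^sub>R e" using q'' by (auto simp: abs_if split: if_splits)
  with e1 q' show thesis by (rule that)
qed

text \<open>
  All later arguments use uniform ellipticity in this form: membership in the tangent balls at
  \<open>q\<close>, of radii \<open>r\<close> and \<open>R\<close>, has become a quadratic inequality in the coordinate along the normal.
\<close>

lemma uniformly_elliptic_normals:
  fixes \<Omega> :: "'h::complex_hilbert set"
  assumes "uniformly_elliptic \<Omega>"
  obtains r R where "0 < r" "r < R"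
    "\<And>q. q \<in> frontier \<Omega> \<Longrightarrow> \<exists>e. norm e = 1 \<and>
      (\<forall>z. (norm (z - q))\<^sup>2 < 2 * r * Re (cinner (z - q) e) \<longrightarrow> z \<in> \<Omega>) \<and>
      (\<forall>z\<in>\<Omega>. (norm (z - q))\<^sup>2 < 2 * R * Re (cinner (z - q) e))"
proof -
  obtain r R where rR: "0 < r" "r < R" and
    ex: "\<forall>q\<in>frontier \<Omega>. \<exists>!p. case p of (q', q'') \<Rightarrow>
        collinear {q, q', q''} \<and>
        ball q' r \<subseteq> \<Omega> \<and> \<Omega> \<subseteq> ball q'' R \<and>
        q \<in> frontier (ball q' r) \<inter> frontier (ball q'' R)"
    using assms unfolding uniformly_elliptic_def by blast
  have "\<exists>e. norm e = 1 \<and>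
      (\<forall>z. (norm (z - q))\<^sup>2 < 2 * r * Re (cinner (z - q) e) \<longrightarrow> z \<in> \<Omega>) \<and>
      (\<forall>z\<in>\<Omega>. (norm (z - q))\<^sup>2 < 2 * R * Re (cinner (z - q) e))" if "q \<in> frontier \<Omega>" for q
  proof -
    from ex that obtain q' q'' where col: "collinear {q, q', q''}"
      and inn: "ball q' r \<subseteq> \<Omega>" and out: "\<Omega> \<subseteq> ball q'' R"
      and fr: "q \<in> frontier (ball q' r)" "q \<in> frontier (ball q'' R)"
      by (fastforce dest: ex1_implies_ex)
    have "norm (q' - q) = r" "norm (q'' - q) = R"
      using fr rR by (simp_all add: frontier_ball dist_norm)
    moreover have "dist q' q'' < R"
      using inn out rR by (metis centre_in_ball dist_commute mem_ball subsetD)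
    ultimately obtain e where e: "norm e = 1" "q' = q + r *\<^sub>R e" "q'' = q + R *\<^sub>R e"
      using tangent_ball_centers[OF _ _ col] rR by (metis less_trans)
    then show ?thesis
      using inn out rR ball_tangent_iff[OF e(1), of r _ q] ball_tangent_iff[OF e(1), of R _ q]
      by (intro exI[of _ e]) auto
  qed
  with rR show thesis by (rule that)
qed

lemma ball_infdist_frontier_subset:
  fixes p :: "'a::real_normed_vector"
  assumes "p \<in> S"
  shows "ball p (infdist p (frontier S)) \<subseteq> S"
proof (rule ccontr)
  assume "\<not> ?thesis"
  then obtain z where "z \<in> ball p (infdist p (frontier S))" and "z \<notin> S"
    by blast
  then have z: "dist p z < infdist p (frontier S)" "z \<notin> S"
    by simp_all
  have "closed_segment p z \<inter> frontier S \<noteq> {}"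
    using assms z(2) by (intro connected_Int_frontier) auto
  then obtain y where y: "y \<in> closed_segment p z" "y \<in> frontier S" by blast
  have "infdist p (frontier S) \<le> dist p y"
    using y(2) by (rule infdist_le)
  also have "\<dots> \<le> dist p z"
    using segment_bound1[OF y(1)] by (simp add: dist_norm norm_minus_commute)
  finally show False using z(1) by simp
qed

text \<open>
  The ball of radius \<open>\<delta>\<close> about \<open>p\<close>, with \<open>\<delta>\<close> its distance to the boundary, lies in the half-space
  bounded by the tangent hyperplane at \<open>q\<close>, so the component of \<open>p - q\<close> along \<open>e\<close> is already at
  least \<open>\<delta>\<close>. If \<open>p - q\<close> is hardly longer than \<open>\<delta>\<close>, nothing is left for the other components. The
  predicate \<open>Q\<close> carries along whatever else is known about the normal at \<open>q\<close>.
\<close>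

lemma nearly_normal_boundary_point:
  fixes \<Omega> :: "'h::complex_hilbert set"
  assumes "open \<Omega>" and p: "p \<in> \<Omega>" and "frontier \<Omega> \<noteq> {}" and "0 < \<eta>"
    and normal: "\<And>q. q \<in> frontier \<Omega> \<Longrightarrow> \<exists>e. norm e = 1 \<and> Q q e \<and> (\<forall>z\<in>\<Omega>. 0 < Re (cinner (z - q) e))"
  obtains q e where "norm e = 1" "Q q e"
    "infdist p (frontier \<Omega>) \<le> Re (cinner (p - q) e)"
    "norm (p - q - infdist p (frontier \<Omega>) *\<^sub>R e) \<le> \<eta> * infdist p (frontier \<Omega>)"
proof -
  define \<delta> where "\<delta> = infdist p (frontier \<Omega>)"
  have "p \<notin> frontier \<Omega>"
    using assms(1) p by (simp add: frontier_def interior_open)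
  then have \<delta>: "0 < \<delta>"
    unfolding \<delta>_def using assms(3) by (intro infdist_pos_not_in_closed) auto
  \<comment> \<open>With this tolerance the identity for \<open>|p - q - \<delta> e|\<^sup>2\<close> leaves exactly \<open>(\<eta> \<delta>)\<^sup>2\<close>.\<close>
  have "\<delta> < \<delta> * sqrt (1 + \<eta>\<^sup>2)"
    using \<delta> \<open>0 < \<eta>\<close> by simp
  then obtain q where q: "q \<in> frontier \<Omega>" "dist p q < \<delta> * sqrt (1 + \<eta>\<^sup>2)"
    using assms(3) unfolding \<delta>_def infdist_notempty[OF assms(3)]
    by (subst (asm) cINF_less_iff) auto
  from normal[OF q(1)] obtain e where e: "norm e = 1" "Q q e"
    and pos: "\<And>z. z \<in> \<Omega> \<Longrightarrow> 0 < Re (cinner (z - q) e)" by blast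
  have deep: "\<delta> \<le> Re (cinner (p - q) e)"
  proof (rule dense_le_bounded[OF \<delta>])
    fix t assume t: "0 < t" "t < \<delta>"
    then have "p - t *\<^sub>R e \<in> \<Omega>"
      using ball_infdist_frontier_subset[OF p] e(1) by (auto simp: \<delta>_def dist_norm)
    from pos[OF this] have "0 < Re (cinner (p - q - t *\<^sub>R e) e)"
      by (simp add: algebra_simps)
    then show "t \<le> Re (cinner (p - q) e)"
      using e(1) by (simp add: cinner_diff_left[of "p - q"] cinner_scaleR_left cinner_self)
  qed
  have "(norm (p - q))\<^sup>2 \<le> (\<delta> * sqrt (1 + \<eta>\<^sup>2))\<^sup>2"
    using q(2) by (intro power_mono) (auto simp: dist_norm)
  then have "(norm (p - q))\<^sup>2 \<le> \<delta>\<^sup>2 * (1 + \<eta>\<^sup>2)"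
    by (simp add: power_mult_distrib)
  moreover have "\<delta> * \<delta> \<le> \<delta> * Re (cinner (p - q) e)"
    using deep \<delta> by simp
  ultimately have "(norm (p - q - \<delta> *\<^sub>R e))\<^sup>2 \<le> (\<eta> * \<delta>)\<^sup>2"
    unfolding norm_diff_scaleR_sq[OF e(1)] by (simp add: algebra_simps power2_eq_square)
  then have "norm (p - q - \<delta> *\<^sub>R e) \<le> \<eta> * \<delta>"
    by (rule power2_le_imp_le) (use \<delta> \<open>0 < \<eta>\<close> in simp)
  with e deep show thesis
    unfolding \<delta>_def by (rule that)
qed

section \<open>Anisotropic Cayley transform\<close>

text \<open>
  The axial factor is the Cayley transform of the right half-plane that vanishes at \<open>\<delta>\<close>. The
  numerator \<open>\<surd>\<delta>\<close> of the other factor is the parabolic scaling: inside a ball tangent to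
  \<open>Re \<zeta> = 0\<close>, the orthogonal part at depth \<open>\<delta>\<close> has length at most of order \<open>\<surd>\<delta>\<close>.
\<close>

definition cayley :: "'a::complex_inner \<Rightarrow> real \<Rightarrow> 'a \<Rightarrow> 'a"
  where "cayley e \<delta> = axial e (\<lambda>\<zeta>. (\<zeta> - \<delta>) / (\<zeta> + \<delta>)) (\<lambda>\<zeta>. sqrt \<delta> / (\<zeta> + \<delta>))"

definition cayley_inv :: "'a::complex_inner \<Rightarrow> real \<Rightarrow> 'a \<Rightarrow> 'a"
  where "cayley_inv e \<delta> = axial e (\<lambda>\<omega>. \<delta> * (1 + \<omega>) / (1 - \<omega>)) (\<lambda>\<omega>. 2 * sqrt \<delta> / (1 - \<omega>))"

lemma cayley_inv_cayley:
  assumes "norm e = 1" "0 < \<delta>" "cinner z e \<noteq> - \<delta>"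
  shows "cayley_inv e \<delta> (cayley e \<delta> z) = z"
proof -
  let ?\<zeta> = "cinner z e"
  obtain d where d: "?\<zeta> + \<delta> = d" by simp
  have nz: "d \<noteq> 0"
    using assms(3) d by (auto simp: eq_neg_iff_add_eq_0)
  have one_minus: "1 - (?\<zeta> - \<delta>) / d = 2 * \<delta> / d"
    and one_plus: "1 + (?\<zeta> - \<delta>) / d = 2 * ?\<zeta> / d"
    using nz by (simp_all add: field_simps flip: d)
  have sq: "complex_of_real (sqrt \<delta>) * complex_of_real (sqrt \<delta>) = \<delta>"
    using assms(2) by (simp flip: of_real_mult)
  show ?thesis
    unfolding cayley_def cayley_inv_def axial_axial[OF assms(1)]
    by (rule axial_eq_self; unfold d one_minus one_plus)
      (use nz assms(2) sq in \<open>simp_all add: field_simps\<close>)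
qed

lemma cayley_cayley_inv:
  assumes "norm e = 1" "0 < \<delta>" "cinner w e \<noteq> 1"
  shows "cayley e \<delta> (cayley_inv e \<delta> w) = w"
proof -
  let ?\<omega> = "cinner w e"
  have nz: "1 - ?\<omega> \<noteq> 0" using assms(3) by simp
  have minus: "\<delta> * (1 + ?\<omega>) / (1 - ?\<omega>) - \<delta> = 2 * \<delta> * ?\<omega> / (1 - ?\<omega>)"
    and plus: "\<delta> * (1 + ?\<omega>) / (1 - ?\<omega>) + \<delta> = 2 * \<delta> / (1 - ?\<omega>)"
    using nz by (simp_all add: field_simps)
  have sq: "complex_of_real (sqrt \<delta>) * complex_of_real (sqrt \<delta>) = \<delta>"
    using assms(2) by (simp flip: of_real_mult)
  show ?thesis
    unfolding cayley_def cayley_inv_def axial_axial[OF assms(1)]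
    by (rule axial_eq_self; unfold minus plus)
      (use nz assms(2) sq in \<open>simp_all add: field_simps\<close>)
qed

lemma holo_on_cayley:
  assumes "norm e = 1"
  shows "cayley e \<delta> holo_on {z. cinner z e \<noteq> - \<delta>}"
  unfolding cayley_def
  by (rule holo_on_axial[OF assms,
        where A' = "\<lambda>\<zeta>. 2 * \<delta> / (\<zeta> + \<delta>)\<^sup>2" and B' = "\<lambda>\<zeta>. - sqrt \<delta> / (\<zeta> + \<delta>)\<^sup>2"])
    (auto intro!: derivative_eq_intros simp: eq_neg_iff_add_eq_0 power2_eq_square field_simps)

lemma holo_on_cayley_inv:
  assumes "norm e = 1"
  shows "cayley_inv e \<delta> holo_on {w. cinner w e \<noteq> 1}"
  unfolding cayley_inv_def
  by (rule holo_on_axial[OF assms,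
        where A' = "\<lambda>\<omega>. 2 * \<delta> / (1 - \<omega>)\<^sup>2" and B' = "\<lambda>\<omega>. 2 * sqrt \<delta> / (1 - \<omega>)\<^sup>2"])
    (auto intro!: derivative_eq_intros simp: power2_eq_square field_simps)

text \<open>
  The axial part stays in the unit disc. For the other part, the outer ball bounds
  \<open>\<delta> |z'|\<^sup>2\<close> by \<open>2 R \<delta> Re \<zeta>\<close>, while \<open>|\<zeta> + \<delta>|\<^sup>2 \<ge> 4 \<delta> Re \<zeta>\<close> by the inequality of arithmetic and
  geometric means; the depth \<open>\<delta>\<close> cancels and \<open>R / 2\<close> remains.
\<close>

lemma cayley_bounded:
  assumes e: "norm e = 1" and "0 < \<delta>" and R: "0 < R"
    and z: "(norm z)\<^sup>2 < 2 * R * Re (cinner z e)" and x: "0 < Re (cinner z e)"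
  shows "(norm (cayley e \<delta> z))\<^sup>2 \<le> 1 + R / 2"
proof -
  let ?\<zeta> = "cinner z e"
  define N where "N = (cmod (?\<zeta> + \<delta>))\<^sup>2"
  have N: "N = (Re ?\<zeta> + \<delta>)\<^sup>2 + (Im ?\<zeta>)\<^sup>2"
    by (simp add: N_def cmod_power2)
  have N0: "0 < N" unfolding N using x \<open>0 < \<delta>\<close> by (intro add_pos_nonneg) auto
  have am_gm: "4 * \<delta> * Re ?\<zeta> \<le> N"
    unfolding N using sum_squares_ge_zero[of "Re ?\<zeta> - \<delta>" "Im ?\<zeta>"]
    by (simp add: power2_eq_square algebra_simps)
  have "(cmod (?\<zeta> - \<delta>))\<^sup>2 = (Re ?\<zeta> - \<delta>)\<^sup>2 + (Im ?\<zeta>)\<^sup>2"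
    by (simp add: cmod_power2)
  then have "(cmod (?\<zeta> - \<delta>))\<^sup>2 \<le> N"
    unfolding N using mult_pos_pos[OF \<open>0 < \<delta>\<close> x] by (simp add: power2_eq_square algebra_simps)
  moreover have "\<delta> * (norm (perp e z))\<^sup>2 \<le> R / 2 * N"
  proof -
    have "(norm (perp e z))\<^sup>2 \<le> 2 * R * Re ?\<zeta>"
      using norm_split[OF e, of z] z zero_le_power2[of "cmod ?\<zeta>"] by linarith
    then have "\<delta> * (norm (perp e z))\<^sup>2 \<le> \<delta> * (2 * R * Re ?\<zeta>)"
      using \<open>0 < \<delta>\<close> by simp
    also have "\<dots> = R / 2 * (4 * \<delta> * Re ?\<zeta>)" by simp
    also have "\<dots> \<le> R / 2 * N" using am_gm R by (intro mult_left_mono) auto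
    finally show ?thesis .
  qed
  moreover have "(norm (cayley e \<delta> z))\<^sup>2 = ((cmod (?\<zeta> - \<delta>))\<^sup>2 + \<delta> * (norm (perp e z))\<^sup>2) / N"
    unfolding cayley_def norm_axial[OF e]
    using \<open>0 < \<delta>\<close> by (simp add: N_def norm_divide power_divide add_divide_distrib)
  ultimately show ?thesis
    using N0 by (simp add: divide_le_eq algebra_simps)
qed

text \<open>
  For the preimage of \<open>w = \<omega> e + w'\<close>, multiplication by \<open>|1 - \<omega>|\<^sup>2 / \<delta>\<close> turns the inequality of the
  inner ball into \<open>\<delta> |1 + \<omega>|\<^sup>2 + 4 |w'|\<^sup>2 < 2 r (1 - |\<omega>|\<^sup>2)\<close>, where \<open>\<delta>\<close> occurs only in a term that
  shrinks with it. The bounds on \<open>\<delta>\<close> and \<open>\<rho>\<close> keep the left side below \<open>33 r / 32\<close> and the right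
  side at least \<open>60 r / 32\<close>.
\<close>

lemma cayley_inv_in_inner_ball:
  assumes e: "norm e = 1" and \<delta>: "0 < \<delta>" "\<delta> \<le> r / 2"
    and \<rho>: "\<rho> \<le> 1 / 4" "16 * \<rho>\<^sup>2 \<le> r" and w: "norm w < \<rho>"
  shows "(norm (cayley_inv e \<delta> w))\<^sup>2 < 2 * r * Re (cinner (cayley_inv e \<delta> w) e)"
proof -
  let ?\<omega> = "cinner w e"
  define N where "N = (cmod (1 - ?\<omega>))\<^sup>2"
  have wsq: "(norm w)\<^sup>2 < \<rho>\<^sup>2"
    using w by (intro power_strict_mono) auto
  have \<omega>: "cmod ?\<omega> \<le> 1 / 4"
  proof -
    have "(cmod ?\<omega>)\<^sup>2 \<le> (norm w)\<^sup>2" using norm_split[OF e, of w] by simp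
    then have "cmod ?\<omega> \<le> norm w" by (rule power2_le_imp_le) simp
    with w \<rho>(1) show ?thesis by simp
  qed
  have N0: "0 < N" using \<omega> by (auto simp: N_def)
  have bot: "(cmod ?\<omega>)\<^sup>2 \<le> (1 / 4)\<^sup>2" using \<omega> by (intro power_mono) auto
  have "cmod (1 + ?\<omega>) \<le> 5 / 4" using norm_triangle_ineq[of 1 ?\<omega>] \<omega> by simp
  then have "(cmod (1 + ?\<omega>))\<^sup>2 \<le> (5 / 4)\<^sup>2" by (intro power_mono) auto
  then have top: "(cmod (1 + ?\<omega>))\<^sup>2 \<le> 25 / 16" by (simp add: power2_eq_square)
  have Re: "Re (cinner (cayley_inv e \<delta> w) e) = \<delta> * (1 - (cmod ?\<omega>)\<^sup>2) / N"
  proof -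
    have "N = (1 - Re ?\<omega>)\<^sup>2 + (Im ?\<omega>)\<^sup>2" "(cmod ?\<omega>)\<^sup>2 = (Re ?\<omega>)\<^sup>2 + (Im ?\<omega>)\<^sup>2"
      by (simp_all add: N_def cmod_power2)
    then show ?thesis
      unfolding cayley_inv_def axial_coord[OF e]
      by (simp add: Re_divide power2_eq_square algebra_simps)
  qed
  have nrm: "(norm (cayley_inv e \<delta> w))\<^sup>2 =
      \<delta> * (\<delta> * (cmod (1 + ?\<omega>))\<^sup>2 + 4 * (norm (perp e w))\<^sup>2) / N"
  proof -
    have "(cmod (\<delta> * (1 + ?\<omega>) / (1 - ?\<omega>)))\<^sup>2 = \<delta>\<^sup>2 * (cmod (1 + ?\<omega>))\<^sup>2 / N"
      and "(cmod (2 * sqrt \<delta> / (1 - ?\<omega>)))\<^sup>2 = 4 * \<delta> / N"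
      using \<delta>(1) by (simp_all add: N_def norm_divide norm_mult power_divide power_mult_distrib)
    then show ?thesis
      unfolding cayley_inv_def norm_axial[OF e]
      by (simp only:) (simp add: add_divide_distrib distrib_left power2_eq_square mult_ac)
  qed
  have "\<delta> * (cmod (1 + ?\<omega>))\<^sup>2 \<le> r / 2 * (25 / 16)"
    using \<delta> top by (intro mult_mono) auto
  moreover have "(norm (perp e w))\<^sup>2 < r / 16"
    using norm_split[OF e, of w] wsq \<rho>(2) zero_le_power2[of "cmod ?\<omega>"] by linarith
  moreover have "2 * r * (15 / 16) \<le> 2 * r * (1 - (cmod ?\<omega>)\<^sup>2)"
    using \<delta> bot by (intro mult_left_mono) (auto simp: power2_eq_square)
  ultimately have "\<delta> * (cmod (1 + ?\<omega>))\<^sup>2 + 4 * (norm (perp e w))\<^sup>2 < 2 * r * (1 - (cmod ?\<omega>)\<^sup>2)"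
    using \<delta> by linarith
  then have "\<delta> * (\<delta> * (cmod (1 + ?\<omega>))\<^sup>2 + 4 * (norm (perp e w))\<^sup>2) < \<delta> * (2 * r * (1 - (cmod ?\<omega>)\<^sup>2))"
    using \<delta>(1) by simp
  then show ?thesis
    unfolding Re nrm using N0 by (simp add: divide_strict_right_mono mult_ac)
qed

text \<open>
  A displacement of relative size \<open>\<eta>\<close> from \<open>\<delta> e\<close> is divided by \<open>|\<zeta> + \<delta>| \<ge> 2 \<delta>\<close>, so the bound on
  the image contains \<open>\<eta>\<close> but does not deteriorate as \<open>\<delta>\<close> tends to \<open>0\<close>.
\<close>

lemma cayley_near_center:
  assumes e: "norm e = 1" and \<delta>: "0 < \<delta>" and Re: "\<delta> \<le> Re (cinner z e)"
    and near: "norm (z - \<delta> *\<^sub>R e) \<le> \<eta> * \<delta>"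
  shows "(norm (cayley e \<delta> z))\<^sup>2 \<le> (1 + \<delta>) * \<eta>\<^sup>2 / 4"
proof -
  let ?\<zeta> = "cinner z e"
  define N where "N = (cmod (?\<zeta> + \<delta>))\<^sup>2"
  have "2 * \<delta> \<le> cmod (?\<zeta> + \<delta>)"
    using Re complex_Re_le_cmod[of "?\<zeta> + \<delta>"] by simp
  then have N: "(2 * \<delta>)\<^sup>2 \<le> N"
    unfolding N_def using \<delta> by (intro power_mono) auto
  have "cinner (z - \<delta> *\<^sub>R e) e = ?\<zeta> - \<delta>"
    using e by (simp add: cinner_diff_left cinner_scaleR_left cinner_self)
  moreover from this have "perp e (z - \<delta> *\<^sub>R e) = perp e z"
    by (simp add: perp_def scaleC.diff_left scaleR_scaleC)
  ultimately have "(cmod (?\<zeta> - \<delta>))\<^sup>2 + (norm (perp e z))\<^sup>2 = (norm (z - \<delta> *\<^sub>R e))\<^sup>2"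
    using norm_split[OF e, of "z - \<delta> *\<^sub>R e"] by simp
  also have "\<dots> \<le> (\<eta> * \<delta>)\<^sup>2"
    using near by (intro power_mono) auto
  finally have sum: "(cmod (?\<zeta> - \<delta>))\<^sup>2 + (norm (perp e z))\<^sup>2 \<le> (\<eta> * \<delta>)\<^sup>2" .
  have "(cmod (?\<zeta> - \<delta>))\<^sup>2 + \<delta> * (norm (perp e z))\<^sup>2
      \<le> (1 + \<delta>) * ((cmod (?\<zeta> - \<delta>))\<^sup>2 + (norm (perp e z))\<^sup>2)"
    using \<delta> by (simp add: algebra_simps)
  also have "\<dots> \<le> (1 + \<delta>) * (\<eta> * \<delta>)\<^sup>2"
    using sum \<delta> by (intro mult_left_mono) auto
  finally have "(cmod (?\<zeta> - \<delta>))\<^sup>2 + \<delta> * (norm (perp e z))\<^sup>2 \<le> (1 + \<delta>) * (\<eta> * \<delta>)\<^sup>2" .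
  moreover have "(norm (cayley e \<delta> z))\<^sup>2 = ((cmod (?\<zeta> - \<delta>))\<^sup>2 + \<delta> * (norm (perp e z))\<^sup>2) / N"
    unfolding cayley_def norm_axial[OF e]
    using \<delta> by (simp add: N_def norm_divide power_divide add_divide_distrib)
  ultimately have "(norm (cayley e \<delta> z))\<^sup>2 \<le> (1 + \<delta>) * (\<eta> * \<delta>)\<^sup>2 / (2 * \<delta>)\<^sup>2"
    using N \<delta> by (auto intro!: frac_le)
  also have "\<dots> = (1 + \<delta>) * \<eta>\<^sup>2 / 4"
    using \<delta> by (simp add: power2_eq_square)
  finally show ?thesis .
qed

section \<open>Uniform squeezing\<close>

text \<open>
  The relative error \<open>\<rho> / sqrt (1 + r)\<close> is what places the image of \<open>p\<close> within \<open>\<rho> / 2\<close> of the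
  origin. A ball of radius \<open>\<rho> / 2\<close> about that image is then still inside the ball of radius \<open>\<rho>\<close>
  about \<open>0\<close> that the image of \<open>\<Omega>\<close> covers, and the resulting ratio of radii contains neither
  \<open>p\<close> nor \<open>\<delta>\<close>.
\<close>

lemma embedding_near_boundary:
  fixes \<Omega> :: "'h::complex_hilbert set"
  assumes dom: "is_domain \<Omega>" and rR: "0 < r" "0 < R"
    and e: "norm e = 1"
    and inner: "\<And>z. (norm (z - q))\<^sup>2 < 2 * r * Re (cinner (z - q) e) \<Longrightarrow> z \<in> \<Omega>"
    and outer: "\<And>z. z \<in> \<Omega> \<Longrightarrow> (norm (z - q))\<^sup>2 < 2 * R * Re (cinner (z - q) e)"
    and p: "p \<in> \<Omega>" and \<delta>: "0 < \<delta>" "\<delta> \<le> r / 2"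
    and \<rho>: "0 < \<rho>" "\<rho> \<le> 1 / 4" "16 * \<rho>\<^sup>2 \<le> r"
    and deep: "\<delta> \<le> Re (cinner (p - q) e)"
    and near: "norm (p - q - \<delta> *\<^sub>R e) \<le> \<rho> / sqrt (1 + r) * \<delta>"
  shows "\<exists>F \<in> holo_embeddings \<Omega> (ball (0::'h) 1). F p = 0 \<and>
    ball 0 (\<rho> / 2 / (sqrt (1 + R / 2) + \<rho>)) \<subseteq> F ` \<Omega>"
proof -
  define f where "f = (\<lambda>z. cayley e \<delta> (z - q))"
  define g where "g = (\<lambda>w. q + cayley_inv e \<delta> w)"
  define U where "U = {w. cinner w e \<noteq> 1}"
  have pos: "0 < Re (cinner (z - q) e)" if "z \<in> \<Omega>" for z
    using order_le_less_trans[OF zero_le_power2 outer[OF that]] rR by (simp add: zero_less_mult_iff)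
  have regular: "cinner (z - q) e \<noteq> - complex_of_real \<delta>" if "z \<in> \<Omega>" for z
    using pos[OF that] \<delta>(1) by auto
  have center: "norm (f p) \<le> \<rho> / 2"
  proof (rule power2_le_imp_le)
    have "(norm (f p))\<^sup>2 \<le> (1 + \<delta>) * (\<rho> / sqrt (1 + r))\<^sup>2 / 4"
      unfolding f_def by (rule cayley_near_center[OF e \<delta>(1) deep near])
    also have "\<dots> = (1 + \<delta>) / (1 + r) * (\<rho> / 2)\<^sup>2"
      using rR by (simp add: power_divide)
    also have "\<dots> \<le> 1 * (\<rho> / 2)\<^sup>2"
      using \<delta> rR by (intro mult_right_mono) auto
    finally show "(norm (f p))\<^sup>2 \<le> (\<rho> / 2)\<^sup>2" by simp
  qed (use \<rho> in simp)
  have U: "f z \<in> U" if "z \<in> \<Omega>" for z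
    using \<delta>(1) regular[OF that]
    by (auto simp: f_def U_def cayley_def axial_coord[OF e] divide_eq_1_iff)
  show ?thesis
  proof (rule pinched_image_embedding[OF dom])
    have shift: "(\<lambda>z. - q + 1 *\<^sub>R z) holo_on \<Omega>" by (rule holo_on_affine)
    show "f holo_on \<Omega>"
      using holo_on_compose[OF shift holo_on_cayley[OF e, of \<delta>]] regular
      by (auto simp: f_def)
    have "continuous_on UNIV (\<lambda>w. cinner w e)"
      using bounded_linear_cinner_left[OF e] by (simp add: linear_continuous_on)
    then show "open U"
      unfolding U_def by (intro open_Collect_neq) (auto intro: continuous_on_const)
    have "(\<lambda>w. q + 1 *\<^sub>R w) holo_on UNIV" by (rule holo_on_affine)
    from holo_on_compose[OF holo_on_cayley_inv[OF e, of \<delta>] this]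
    show "g holo_on U" by (simp add: g_def U_def)
    show "f ` \<Omega> \<subseteq> U" using U by blast
    show "g (f z) = z" if "z \<in> \<Omega>" for z
      using cayley_inv_cayley[OF e \<delta>(1) regular[OF that]] by (simp add: f_def g_def)
    show fg: "f (g w) = w" if "w \<in> U" for w
      using cayley_cayley_inv[OF e \<delta>(1)] that by (simp add: f_def g_def U_def)
    show "0 < sqrt (1 + R / 2) + \<rho>"
      using rR \<rho>(1) by (intro add_nonneg_pos) auto
    show "f ` \<Omega> \<subseteq> ball (f p) (sqrt (1 + R / 2) + \<rho>)"
    proof clarify
      fix z assume z: "z \<in> \<Omega>"
      have "norm (f z) \<le> sqrt (1 + R / 2)"
        unfolding f_def
        by (rule real_le_rsqrt, rule cayley_bounded[OF e \<delta>(1) rR(2) outer[OF z] pos[OF z]])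
      then have "norm (f p - f z) < sqrt (1 + R / 2) + \<rho>"
        using norm_triangle_ineq4[of "f p" "f z"] center \<rho>(1) by linarith
      then show "f z \<in> ball (f p) (sqrt (1 + R / 2) + \<rho>)"
        by (simp add: dist_norm)
    qed
    show "ball (f p) (\<rho> / 2) \<subseteq> f ` \<Omega>"
    proof
      fix w assume "w \<in> ball (f p) (\<rho> / 2)"
      then have w: "norm w < \<rho>"
        using norm_triangle_sub[of w "f p"] center by (simp add: dist_norm norm_minus_commute)
      have "w \<in> U"
      proof -
        have "(cmod (cinner w e))\<^sup>2 \<le> (norm w)\<^sup>2"
          using norm_split[OF e, of w] by simp
        then have "cmod (cinner w e) \<le> norm w" by (rule power2_le_imp_le) simp
        with w \<rho>(2) show ?thesis by (auto simp: U_def)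
      qed
      moreover have "g w \<in> \<Omega>"
        using cayley_inv_in_inner_ball[OF e \<delta> \<rho>(2,3) w] by (intro inner) (simp add: g_def)
      ultimately show "w \<in> f ` \<Omega>" using fg by (metis imageI)
    qed
  qed
qed

text \<open>
  Points with \<open>ball p (r / 2) \<subseteq> \<Omega>\<close> are handled by a similarity. This also covers an empty frontier,
  which occurs for the zero space; otherwise the distance to the frontier is at most \<open>r / 2\<close> and the
  Cayley transform applies.
\<close>

lemma uniformly_elliptic_uniform_embeddings:
  fixes \<Omega> :: "'h::complex_hilbert set"
  assumes "uniformly_elliptic \<Omega>"
  obtains \<kappa> where "0 < \<kappa>"
    "\<And>p. p \<in> \<Omega> \<Longrightarrow> \<exists>F \<in> holo_embeddings \<Omega> (ball (0::'h) 1). F p = 0 \<and> ball 0 \<kappa> \<subseteq> F ` \<Omega>"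
proof -
  from assms have dom: "is_domain \<Omega>" and bdd: "bounded \<Omega>" and op: "open \<Omega>"
    by (auto simp: uniformly_elliptic_def is_domain_def)
  obtain r R where rR: "0 < r" "r < R" and
    normal: "\<And>q. q \<in> frontier \<Omega> \<Longrightarrow> \<exists>e. norm e = 1 \<and>
      (\<forall>z. (norm (z - q))\<^sup>2 < 2 * r * Re (cinner (z - q) e) \<longrightarrow> z \<in> \<Omega>) \<and>
      (\<forall>z\<in>\<Omega>. (norm (z - q))\<^sup>2 < 2 * R * Re (cinner (z - q) e))"
    using uniformly_elliptic_normals[OF assms] by blast
  define M where "M = diameter \<Omega> + 1"
  have M: "0 < M" "\<And>p z. p \<in> \<Omega> \<Longrightarrow> z \<in> \<Omega> \<Longrightarrow> dist p z < M"
    using diameter_ge_0[OF bdd] diameter_bounded_bound[OF bdd] by (fastforce simp: M_def)+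
  define \<rho> where "\<rho> = min (1 / 4) (sqrt r / 4)"
  have \<rho>: "0 < \<rho>" "\<rho> \<le> 1 / 4" using rR by (auto simp: \<rho>_def)
  have "\<rho>\<^sup>2 \<le> (sqrt r / 4)\<^sup>2"
    using \<rho>(1) by (intro power_mono) (auto simp: \<rho>_def)
  then have \<rho>sq: "16 * \<rho>\<^sup>2 \<le> r" using rR by (simp add: power_divide)
  define \<kappa>\<^sub>1 where "\<kappa>\<^sub>1 = r / 2 / M"
  define \<kappa>\<^sub>2 where "\<kappa>\<^sub>2 = \<rho> / 2 / (sqrt (1 + R / 2) + \<rho>)"
  have "0 < sqrt (1 + R / 2) + \<rho>" using rR \<rho>(1) by (intro add_nonneg_pos) auto
  then have "0 < min \<kappa>\<^sub>1 \<kappa>\<^sub>2"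
    using rR M(1) \<rho>(1) by (simp add: \<kappa>\<^sub>1_def \<kappa>\<^sub>2_def)
  moreover have "\<exists>F \<in> holo_embeddings \<Omega> (ball (0::'h) 1). F p = 0 \<and> ball 0 (min \<kappa>\<^sub>1 \<kappa>\<^sub>2) \<subseteq> F ` \<Omega>"
    if p: "p \<in> \<Omega>" for p
  proof (cases "ball p (r / 2) \<subseteq> \<Omega>")
    case True
    have id: "(\<lambda>z::'h. z) holo_on X" for X
      using holo_on_affine[of 0 1] by simp
    have "\<exists>F \<in> holo_embeddings \<Omega> (ball (0::'h) 1). F p = 0 \<and> ball 0 \<kappa>\<^sub>1 \<subseteq> F ` \<Omega>"
      unfolding \<kappa>\<^sub>1_def
      by (rule pinched_image_embedding[OF dom id open_UNIV id])
        (use M p True in auto)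
    then show ?thesis by (meson min.cobounded1 subset_ball subset_trans)
  next
    case False
    define \<delta> where "\<delta> = infdist p (frontier \<Omega>)"
    have ne: "frontier \<Omega> \<noteq> {}"
      using False p frontier_eq_empty[of \<Omega>] by auto
    have "p \<notin> frontier \<Omega>"
      using op p by (simp add: frontier_def interior_open)
    then have \<delta>0: "0 < \<delta>"
      unfolding \<delta>_def using ne by (intro infdist_pos_not_in_closed) auto
    have \<delta>: "\<delta> \<le> r / 2"
      using ball_infdist_frontier_subset[OF p] False unfolding \<delta>_def
      by (meson linear subset_ball subset_trans)
    have "0 < \<rho> / sqrt (1 + r)" using \<rho>(1) rR by simp
    moreover have "\<exists>e. norm e = 1 \<and>
        ((\<forall>z. (norm (z - q))\<^sup>2 < 2 * r * Re (cinner (z - q) e) \<longrightarrow> z \<in> \<Omega>) \<and>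
         (\<forall>z\<in>\<Omega>. (norm (z - q))\<^sup>2 < 2 * R * Re (cinner (z - q) e))) \<and>
        (\<forall>z\<in>\<Omega>. 0 < Re (cinner (z - q) e))" if "q \<in> frontier \<Omega>" for q
    proof -
      from normal[OF that] obtain e where e: "norm e = 1"
        "\<forall>z. (norm (z - q))\<^sup>2 < 2 * r * Re (cinner (z - q) e) \<longrightarrow> z \<in> \<Omega>"
        "\<forall>z\<in>\<Omega>. (norm (z - q))\<^sup>2 < 2 * R * Re (cinner (z - q) e)" by blast
      have "0 < Re (cinner (z - q) e)" if "z \<in> \<Omega>" for z
      proof -
        have "0 < 2 * R * Re (cinner (z - q) e)"
          using e(3) that by (meson order_le_less_trans zero_le_power2)
        then show ?thesis using rR by (simp add: zero_less_mult_iff)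
      qed
      with e show ?thesis by blast
    qed
    ultimately obtain q e where e: "norm e = 1"
      and Q: "(\<forall>z. (norm (z - q))\<^sup>2 < 2 * r * Re (cinner (z - q) e) \<longrightarrow> z \<in> \<Omega>) \<and>
         (\<forall>z\<in>\<Omega>. (norm (z - q))\<^sup>2 < 2 * R * Re (cinner (z - q) e))"
      and deep: "\<delta> \<le> Re (cinner (p - q) e)"
      and near: "norm (p - q - \<delta> *\<^sub>R e) \<le> \<rho> / sqrt (1 + r) * \<delta>"
      unfolding \<delta>_def by (rule nearly_normal_boundary_point[OF op p ne])
    have "\<exists>F \<in> holo_embeddings \<Omega> (ball (0::'h) 1). F p = 0 \<and> ball 0 \<kappa>\<^sub>2 \<subseteq> F ` \<Omega>"
      unfolding \<kappa>\<^sub>2_def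
      by (rule embedding_near_boundary[OF dom rR(1) _ e _ _ p \<delta>0 \<delta> \<rho> \<rho>sq deep near])
        (use rR Q in auto)
    then show ?thesis by (meson min.cobounded2 subset_ball subset_trans)
  qed
  ultimately show thesis by (rule that)
qed

theorem theorem5p3:
  fixes \<Omega> :: "'h::complex_hilbert set"
  assumes "uniformly_elliptic \<Omega>"
  shows "HHR TYPE('h) \<Omega>"
proof -
  from assms have dom: "is_domain \<Omega>" and bdd: "bounded \<Omega>"
    by (auto simp: uniformly_elliptic_def)
  obtain \<kappa> where \<kappa>: "0 < \<kappa>" and
    emb: "\<And>p. p \<in> \<Omega> \<Longrightarrow> \<exists>F \<in> holo_embeddings \<Omega> (ball (0::'h) 1). F p = 0 \<and> ball 0 \<kappa> \<subseteq> F ` \<Omega>"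
    using uniformly_elliptic_uniform_embeddings[OF assms] by blast
  have "ereal \<kappa> \<le> squeezing TYPE('h) \<Omega> p" if "p \<in> \<Omega>" for p
    unfolding squeezing_def using \<kappa> emb[OF that] by (intro Sup_upper) blast
  then have "ereal \<kappa> \<le> (INF p\<in>\<Omega>. squeezing TYPE('h) \<Omega> p)"
    by (rule INF_greatest)
  moreover have "0 < ereal \<kappa>" using \<kappa> by simp
  ultimately have "0 < (INF p\<in>\<Omega>. squeezing TYPE('h) \<Omega> p)"
    by (rule order.strict_trans2[rotated])
  moreover have "holo_embeddings \<Omega> (ball (0::'h) 1) \<noteq> {}"
    using dom emb unfolding is_domain_def by blast
  ultimately show ?thesis
    using dom bdd by (simp add: HHR_def)
qed

end
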